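(* Consider an MTDC system with $n\ge2$ terminals controlled by the decentralized PI controller $$u_i=-K_i^P(V_i-V_i^{\text{nom}})-K_i^Iz_i,\qquad \dot z_i=V_i-V_i^{\text{nom}},\qquad i\in\mathcal{V},$$ with gains $K_i^P>0$, $K_i^I>0$. Then the current-sharing objective is in general not satisfied; that is, for any cost coefficients $f_1,\dots,f_n>0$ there exist a constant disturbance $I^{\text{inj}}\in\mathbb{R}^n$ and a closed-loop solution for which it is not the case that $\lim_{t\to\infty}u(t)=u^*$, where $u^*$ is the optimal current injection for these cost coefficients.
   Context: MTDC system: let $\mathcal{G}$ be a fixed, undirected, connected graph with vertex set $\mathcal{V}=\{1,\dots,n\}$ (terminals) and edge set $\mathcal{E}$ (lines); the neighbours of $i$ are $\mathcal{N}_i$. Each edge $(i,j)$ has resistance $R_{ij}=R_{ji}>0$ and each terminal has capacitance $C_i>0$. The voltages obey $C_i\dot V_i=-\sum_{j\in\mathcal{N}_i}\frac{1}{R_{ij}}(V_i-V_j)+I_i^{\text{inj}}+u_i$ for $i\in\mathcal{V}$, where $I_i^{\text{inj}}$ is a constant uncontrolled injected current (disturbance) and $u_i$ is the controlled injected current. Let $\mathcal{L}_R$ be the weighted graph Laplacian with edge weights $1/R_{ij}$. The nominal voltages are equal: $V_i^{\text{nom}}=V_j^{\text{nom}}$ for all $i,j\in\mathcal{V}$. Current-sharing objective with cost coefficients $f_i>0$: $\lim_{t\to\infty}u(t)=u^*$, where $u^*$ is the (unique) $u$-component of a minimizer $[u^*,V^*]$ of $\sum_{i\in\mathcal{V}}\frac12f_iu_i^2$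 over $[u,V]\in\mathbb{R}^n\times\mathbb{R}^n$ subject to $\mathcal{L}_RV=I^{\text{inj}}+u$. *)

theory Defs
  imports "HOL-Analysis.Analysis"
begin

text \<open>
  The terminals are the elements of a finite type \<open>'n\<close>, so that \<open>n = CARD('n)\<close>. An undirected
  line between \<open>i\<close> and \<open>j\<close> is represented by the two pairs \<open>(i, j)\<close> and \<open>(j, i)\<close> in \<open>E\<close>. Values
  of \<open>R\<close> outside \<open>E\<close> are never used.
\<close>

locale mtdc_network =
  fixes E :: "('n::finite \<times> 'n) set"
    and R :: "'n \<Rightarrow> 'n \<Rightarrow> real"
    and C :: "'n \<Rightarrow> real"
  assumes sym_E: "sym E"
    and irrefl_E: "irrefl E"
    and connected_E: "(i, j) \<in> E\<^sup>*"
    and R_sym: "(i, j) \<in> E \<Longrightarrow> R i j = R j i"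
    and R_pos: "(i, j) \<in> E \<Longrightarrow> R i j > 0"
    and C_pos: "C i > 0"

definition neighbours :: "('n \<times> 'n) set \<Rightarrow> 'n \<Rightarrow> 'n set" where
  "neighbours E i = {j. (i, j) \<in> E}"

definition laplacian :: "('n::finite \<times> 'n) set \<Rightarrow> ('n \<Rightarrow> 'n \<Rightarrow> real) \<Rightarrow> real^'n^'n" where
  "laplacian E R = (\<chi> i j. if i = j then \<Sum>k\<in>neighbours E i. 1 / R i k
                           else if (i, j) \<in> E then - (1 / R i j) else 0)"

text \<open>
  Solutions live on \<open>[0, \<infinity>)\<close>, with a one-sided derivative at \<open>t = 0\<close>; the initial state is
  unconstrained.
\<close>

definition voltage_dynamics ::
  "('n::finite \<times> 'n) set \<Rightarrow> ('n \<Rightarrow> 'n \<Rightarrow> real) \<Rightarrow> ('n \<Rightarrow> real) \<Rightarrow> real^'n \<Rightarrow>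
   (real \<Rightarrow> real^'n) \<Rightarrow> (real \<Rightarrow> real^'n) \<Rightarrow> bool" where
  "voltage_dynamics E R C Iinj u V \<longleftrightarrow>
     (\<forall>t\<ge>0. \<forall>i. \<exists>D. ((\<lambda>s. V s $ i) has_real_derivative D) (at t within {0..}) \<and>
        C i * D = - (\<Sum>j\<in>neighbours E i. 1 / R i j * (V t $ i - V t $ j)) + Iinj $ i + u t $ i)"

definition pi_control ::
  "('n::finite \<Rightarrow> real) \<Rightarrow> ('n \<Rightarrow> real) \<Rightarrow> real^'n \<Rightarrow> real^'n \<Rightarrow> real^'n \<Rightarrow> real^'n" where
  "pi_control KP KI Vnom v z = (\<chi> i. - KP i * (v $ i - Vnom $ i) - KI i * z $ i)"

definition pi_closed_loop_solution ::
  "('n::finite \<times> 'n) set \<Rightarrow> ('n \<Rightarrow> 'n \<Rightarrow> real) \<Rightarrow> ('n \<Rightarrow> real) \<Rightarrow> real^'n \<Rightarrow>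
   ('n \<Rightarrow> real) \<Rightarrow> ('n \<Rightarrow> real) \<Rightarrow> real^'n \<Rightarrow> (real \<Rightarrow> real^'n) \<Rightarrow> (real \<Rightarrow> real^'n) \<Rightarrow> bool" where
  "pi_closed_loop_solution E R C Vnom KP KI Iinj V z \<longleftrightarrow>
     voltage_dynamics E R C Iinj (\<lambda>t. pi_control KP KI Vnom (V t) (z t)) V \<and>
     (\<forall>t\<ge>0. \<forall>i. ((\<lambda>s. z s $ i) has_real_derivative (V t $ i - Vnom $ i)) (at t within {0..}))"

definition injection_cost :: "('n::finite \<Rightarrow> real) \<Rightarrow> real^'n \<Rightarrow> real" where
  "injection_cost f u = (\<Sum>i\<in>UNIV. 1 / 2 * f i * (u $ i)\<^sup>2)"

definition is_cost_minimizer ::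
  "('n::finite \<times> 'n) set \<Rightarrow> ('n \<Rightarrow> 'n \<Rightarrow> real) \<Rightarrow> ('n \<Rightarrow> real) \<Rightarrow> real^'n \<Rightarrow>
   (real^'n) \<times> (real^'n) \<Rightarrow> bool" where
  "is_cost_minimizer E R f Iinj =
     is_arg_min (\<lambda>(u, V). injection_cost f u) (\<lambda>(u, V). laplacian E R *v V = Iinj + u)"

text \<open>The description below is proper by \<open>ex1_optimal_injection\<close>.\<close>

definition optimal_injection ::
  "('n::finite \<times> 'n) set \<Rightarrow> ('n \<Rightarrow> 'n \<Rightarrow> real) \<Rightarrow> ('n \<Rightarrow> real) \<Rightarrow> real^'n \<Rightarrow> real^'n" where
  "optimal_injection E R f Iinj = (THE u. \<exists>V. is_cost_minimizer E R f Iinj (u, V))"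

definition current_sharing ::
  "('n::finite \<times> 'n) set \<Rightarrow> ('n \<Rightarrow> 'n \<Rightarrow> real) \<Rightarrow> ('n \<Rightarrow> real) \<Rightarrow> real^'n \<Rightarrow>
   (real \<Rightarrow> real^'n) \<Rightarrow> bool" where
  "current_sharing E R f Iinj u \<longleftrightarrow> (u \<longlongrightarrow> optimal_injection E R f Iinj) at_top"

lemma laplacian_mult:
  fixes E :: "('n::finite \<times> 'n) set"
  assumes "irrefl E"
  shows "(laplacian E R *v x) $ i = (\<Sum>j\<in>neighbours E i. 1 / R i j * (x $ i - x $ j))"
proof -
  let ?N = "neighbours E i"
  have iN: "i \<notin> ?N"
    using assms by (auto simp: neighbours_def irrefl_def)
  have "(laplacian E R *v x) $ i = (\<Sum>j\<in>UNIV. laplacian E R $ i $ j * x $ j)"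
    by (simp add: matrix_vector_mult_def)
  also have "\<dots> = (\<Sum>j\<in>UNIV. (if j = i then (\<Sum>k\<in>?N. 1 / R i k) * x $ i else 0)
                         + (if j \<in> ?N then - (1 / R i j) * x $ j else 0))"
    using iN by (intro sum.cong) (auto simp: laplacian_def neighbours_def)
  also have "\<dots> = (\<Sum>k\<in>?N. 1 / R i k) * x $ i + (\<Sum>j\<in>?N. - (1 / R i j) * x $ j)"
    by (simp add: sum.distrib sum.If_cases)
  also have "\<dots> = (\<Sum>j\<in>?N. 1 / R i j * (x $ i - x $ j))"
    by (simp add: sum_distrib_right sum_negf sum_subtractf right_diff_distrib)
  finally show ?thesis .
qed

context mtdc_network
begin

lemma transpose_laplacian: "transpose (laplacian E R) = laplacian E R"
  using sym_E R_sym by (auto simp: laplacian_def transpose_def vec_eq_iff sym_def)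

lemma laplacian_ker:
  assumes "laplacian E R *v x = 0"
  shows "x $ i = x $ j"
proof -
  define m where "m = Max (range (($) x))"
  have le: "x $ k \<le> m" for k
    by (simp add: m_def)
  have "m \<in> range (($) x)"
    unfolding m_def by (rule Max_in) auto
  then obtain a where a: "x $ a = m" by auto
  have step: "x $ l = m" if "x $ k = m" "(k, l) \<in> E" for k l
  proof -
    have "(\<Sum>j\<in>neighbours E k. 1 / R k j * (x $ k - x $ j)) = 0"
      using assms laplacian_mult[OF irrefl_E, of R x k] by simp
    moreover have "\<forall>j\<in>neighbours E k. 0 \<le> 1 / R k j * (x $ k - x $ j)"
      using that(1) le R_pos by (auto simp: neighbours_def intro!: divide_nonneg_pos)
    ultimately have "1 / R k l * (x $ k - x $ l) = 0"
      using that(2) sum_nonneg_eq_0_iff[of "neighbours E k" "\<lambda>j. 1 / R k j * (x $ k - x $ j)"]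
      by (simp add: neighbours_def)
    then show ?thesis
      using R_pos[OF that(2)] that(1) by simp
  qed
  have "x $ k = m" for k
    using connected_E[of a k] by (induction rule: rtrancl_induct) (use a step in auto)
  then show ?thesis
    by simp
qed

lemma laplacian_solvable_iff: "(\<exists>V. laplacian E R *v V = y) \<longleftrightarrow> (\<Sum>i\<in>UNIV. y $ i) = 0"
proof
  let ?L = "laplacian E R"
  have one: "?L *v 1 = 0"
    by (simp add: vec_eq_iff laplacian_mult[OF irrefl_E])
  have inner_one: "1 \<bullet> w = (\<Sum>i\<in>UNIV. w $ i)" for w :: "real^'n"
    by (simp add: inner_vec_def)
  {
    assume "\<exists>V. ?L *v V = y"
    then obtain V where "y = ?L *v V" by auto
    then have "1 \<bullet> y = (?L *v 1) \<bullet> V"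
      by (metis dot_lmul_matrix transpose_laplacian vector_transpose_matrix)
    then show "(\<Sum>i\<in>UNIV. y $ i) = 0"
      by (simp add: one inner_one)
  }
  assume y: "(\<Sum>i\<in>UNIV. y $ i) = 0"
  have lin: "linear ((*v) ?L)" by simp
  have adj: "adjoint ((*v) ?L) = (*v) ?L"
    using adjoint_matrix[of ?L] by (simp add: transpose_laplacian)
  have "range ((*v) ?L) = ((*v) ?L -` {0})\<^sup>\<bottom>"
    using ker_orthogonal_comp_adjoint[OF lin] orthogonal_comp_self[OF linear_subspace_image[OF lin subspace_UNIV]]
    by (simp add: adj)
  moreover have "y \<in> ((*v) ?L -` {0})\<^sup>\<bottom>"
  proof -
    have "y \<bullet> x = 0" if "?L *v x = 0" for x
    proof -
      define c where "c = x $ undefined"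
      have "x $ i = c" for i
        unfolding c_def by (rule laplacian_ker[OF that])
      then have "y \<bullet> x = (\<Sum>i\<in>UNIV. y $ i) * c"
        by (simp add: inner_vec_def sum_distrib_right)
      then show ?thesis using y by simp
    qed
    then show ?thesis
      by (auto simp: orthogonal_comp_def orthogonal_def inner_commute)
  qed
  ultimately have "y \<in> range ((*v) ?L)" by (rule ssubst)
  then show "\<exists>V. ?L *v V = y" by auto
qed

lemma ex1_optimal_injection:
  assumes f: "\<And>i. f i > 0"
  shows "\<exists>!u. \<exists>V. is_cost_minimizer E R f Iinj (u, V)"
proof -
  let ?L = "laplacian E R"
  define S where "S = (\<Sum>i\<in>UNIV. 1 / f i)"
  define lam where "lam = - (\<Sum>i\<in>UNIV. Iinj $ i) / S"
  define w :: "real^'n" where "w = (\<chi> i. lam / f i)"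
  have S: "S > 0"
    unfolding S_def using f by (intro sum_pos) auto
  have sum_w: "(\<Sum>i\<in>UNIV. w $ i) = - (\<Sum>i\<in>UNIV. Iinj $ i)"
  proof -
    have "(\<Sum>i\<in>UNIV. w $ i) = lam * S"
      by (simp add: w_def S_def sum_distrib_left)
    then show ?thesis using S by (simp add: lam_def)
  qed
  have "(\<Sum>i\<in>UNIV. (Iinj + w) $ i) = 0"
    using sum_w by (simp add: sum.distrib)
  then obtain Vw where Vw: "?L *v Vw = Iinj + w"
    using laplacian_solvable_iff by blast
  have diff: "injection_cost f u - injection_cost f w = injection_cost f (u - w)"
    if "?L *v V = Iinj + u" for u V
  proof -
    have "(\<Sum>i\<in>UNIV. (Iinj + u) $ i) = 0"
      using that laplacian_solvable_iff by blast
    then have "(\<Sum>i\<in>UNIV. u $ i) = - (\<Sum>i\<in>UNIV. Iinj $ i)"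
      by (simp add: sum.distrib)
    then have *: "(\<Sum>i\<in>UNIV. lam * (u $ i - w $ i)) = 0"
      using sum_w by (simp add: sum_subtractf flip: sum_distrib_left)
    have "injection_cost f u - injection_cost f w
          = (\<Sum>i\<in>UNIV. 1/2 * f i * ((u - w) $ i)\<^sup>2 + f i * w $ i * (u $ i - w $ i))"
      unfolding injection_cost_def sum_subtractf[symmetric]
      by (intro sum.cong refl) (simp add: power2_eq_square algebra_simps)
    also have "\<dots> = injection_cost f (u - w) + (\<Sum>i\<in>UNIV. f i * w $ i * (u $ i - w $ i))"
      by (simp add: injection_cost_def sum.distrib)
    also have "(\<Sum>i\<in>UNIV. f i * w $ i * (u $ i - w $ i)) = (\<Sum>i\<in>UNIV. lam * (u $ i - w $ i))"
      using f by (intro sum.cong refl) (simp add: w_def less_imp_neq[symmetric])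
    finally show ?thesis using * by simp
  qed
  have pos: "injection_cost f x > 0" if "x \<noteq> 0" for x
  proof -
    from that obtain k where "x $ k \<noteq> 0" by (auto simp: vec_eq_iff)
    then show ?thesis
      unfolding injection_cost_def using f
      by (intro sum_pos2[where i = k]) (auto simp: less_imp_le)
  qed
  show ?thesis
  proof (rule ex1I[of _ w])
    have "injection_cost f w \<le> injection_cost f u" if "?L *v V = Iinj + u" for u V
      using diff[OF that] pos[of "u - w"] by (cases "u = w") auto
    then show "\<exists>V. is_cost_minimizer E R f Iinj (w, V)"
      using Vw by (intro exI[of _ Vw]) (force simp: is_cost_minimizer_def is_arg_min_linorder)
  next
    fix u assume "\<exists>V. is_cost_minimizer E R f Iinj (u, V)"
    then obtain V where V: "?L *v V = Iinj + u" and "injection_cost f u \<le> injection_cost f w"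
      using Vw by (force simp: is_cost_minimizer_def is_arg_min_linorder)
    then show "u = w"
      using diff[OF V] pos[of "u - w"] by (cases "u = w") auto
  qed
qed

end

end

theory Submission
  imports Defs
begin

text \<open>
  The integrators of the decentralized controller force every voltage to its nominal value at
  rest. Since the nominal voltages agree, no current flows through the lines at rest, so each
  terminal has to cancel its own disturbance: the equilibrium input is \<open>u = - Iinj\<close>
  (\<open>pi_equilibrium\<close>). An optimal injection depends on the disturbance only through
  \<open>\<Sum>i. Iinj\<^sub>i\<close>: the total is shared so that the marginal costs \<open>f\<^sub>i u\<^sub>i\<close> agree at all terminals
  (\<open>minimizer_equal_marginal_cost\<close>). A disturbance at a single terminal separates the two:
  the controller leaves all other inputs at zero, whereas the optimum uses every terminal. The
  solution that starts at the equilibrium has constant input, hence its input does not converge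
  to the optimal one.
\<close>

text \<open>
  Moving an amount \<open>s\<close> of injected current from terminal \<open>j\<close> to terminal \<open>i\<close> changes the cost by
  \<open>s (f\<^sub>i u\<^sub>i - f\<^sub>j u\<^sub>j) + s\<^sup>2 (f\<^sub>i + f\<^sub>j) / 2\<close>, which is negative for a suitable \<open>s\<close> unless the
  marginal costs agree. The move keeps the total current, and feasibility depends on \<open>u\<close> only
  through that total.
\<close>

lemma (in mtdc_network) minimizer_equal_marginal_cost:
  assumes f: "\<And>i. f i > 0"
    and min: "is_cost_minimizer E R f Iinj (u, V)"
  shows "f i * u $ i = f j * u $ j"
proof (cases "i = j")
  case False
  define d where "d = f i * u $ i - f j * u $ j"
  \<comment> \<open>the minimizer of the quadratic cost change\<close>
  define s where "s = - d / (f i + f j)"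
  define u' where "u' = u + axis i s - axis j s"
  have u'_nth: "u' $ k = u $ k + (if k = i then s else 0) - (if k = j then s else 0)" for k
    by (simp add: u'_def axis_def)
  have feasible: "laplacian E R *v V = Iinj + u"
    and optimal: "\<And>v W. laplacian E R *v W = Iinj + v \<Longrightarrow> injection_cost f u \<le> injection_cost f v"
    using min by (auto simp: is_cost_minimizer_def is_arg_min_linorder)
  have "(\<Sum>k\<in>UNIV. (Iinj + u') $ k) = (\<Sum>k\<in>UNIV. (Iinj + u) $ k)"
    by (simp add: u'_nth sum.distrib sum_subtractf)
  also have "\<dots> = 0"
    using feasible laplacian_solvable_iff by blast
  finally obtain W where "laplacian E R *v W = Iinj + u'"
    using laplacian_solvable_iff by blast
  then have "injection_cost f u \<le> injection_cost f u'"
    by (rule optimal)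
  also have "injection_cost f u' = (\<Sum>k\<in>UNIV. 1 / 2 * f k * (u $ k)\<^sup>2
      + (if k = i then s * f i * u $ i + s\<^sup>2 * f i / 2 else 0)
      + (if k = j then s\<^sup>2 * f j / 2 - s * f j * u $ j else 0))"
    unfolding injection_cost_def using False
    by (intro sum.cong refl) (auto simp: u'_nth power2_eq_square algebra_simps)
  also have "\<dots> = injection_cost f u + s * d + s\<^sup>2 * (f i + f j) / 2"
    by (simp add: sum.distrib injection_cost_def d_def algebra_simps add_divide_distrib)
  also have "\<dots> = injection_cost f u - d\<^sup>2 / (2 * (f i + f j))"
    using f[of i] f[of j] by (simp add: s_def power2_eq_square divide_simps) (simp add: algebra_simps)
  finally have "d\<^sup>2 / (2 * (f i + f j)) \<le> 0"
    by simp
  then have "d = 0"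
    using f[of i] f[of j] by (simp add: divide_le_0_iff)
  then show ?thesis
    by (simp add: d_def)
qed simp

lemma (in mtdc_network) optimal_injection_equal_marginal_cost:
  assumes "\<And>i. f i > 0"
  shows "f i * optimal_injection E R f Iinj $ i = f j * optimal_injection E R f Iinj $ j"
  using theI'[OF ex1_optimal_injection[where f = f and Iinj = Iinj, OF assms]]
    minimizer_equal_marginal_cost[where f = f and Iinj = Iinj, OF assms]
  by (auto simp: optimal_injection_def)

text \<open>
  At nominal voltages there are no line currents and no proportional action, so the integrator
  state alone has to cancel the disturbance.
\<close>

lemma pi_equilibrium:
  fixes E :: "('n::finite \<times> 'n) set" and Iinj Vnom :: "real^'n"
  assumes nom: "\<And>i j. Vnom $ i = Vnom $ j"
    and KI: "\<And>i. KI i > 0"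
  defines "z \<equiv> (\<chi> i. Iinj $ i / KI i)"
  shows "pi_control KP KI Vnom Vnom z = - Iinj"
    and "pi_closed_loop_solution E R C Vnom KP KI Iinj (\<lambda>t. Vnom) (\<lambda>t. z)"
proof -
  show u: "pi_control KP KI Vnom Vnom z = - Iinj"
    using KI by (simp add: pi_control_def z_def vec_eq_iff less_imp_neq[symmetric])
  have "(\<Sum>j\<in>neighbours E i. 1 / R i j * (Vnom $ i - Vnom $ j)) = 0" for i
    by (intro sum.neutral) (metis cancel_comm_monoid_add_class.diff_cancel mult_zero_right nom)
  then show "pi_closed_loop_solution E R C Vnom KP KI Iinj (\<lambda>t. Vnom) (\<lambda>t. z)"
    by (auto simp: pi_closed_loop_solution_def voltage_dynamics_def u intro!: exI[of _ 0])
qed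

theorem lemma5:
  fixes E :: "('n::finite \<times> 'n) set"
    and R :: "'n \<Rightarrow> 'n \<Rightarrow> real"
    and C KP KI f :: "'n \<Rightarrow> real"
    and Vnom :: "real^'n"
  assumes "CARD('n) \<ge> 2"
    and "mtdc_network E R C"
    and "\<And>i j. Vnom $ i = Vnom $ j"
    and "\<And>i. KP i > 0"
    and "\<And>i. KI i > 0"
    and "\<And>i. f i > 0"
  shows "\<exists>(Iinj :: real^'n) V z.
           pi_closed_loop_solution E R C Vnom KP KI Iinj V z \<and>
           \<not> current_sharing E R f Iinj (\<lambda>t. pi_control KP KI Vnom (V t) (z t))"
proof -
  interpret mtdc_network E R C by fact
  obtain a b :: 'n where "a \<noteq> b"
    using assms(1) card_le_Suc0_iff_eq[of "UNIV :: 'n set"] by force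
  define Iinj :: "real^'n" where "Iinj = axis a 1"
  define z :: "real^'n" where "z = (\<chi> i. Iinj $ i / KI i)"
  have u: "pi_control KP KI Vnom Vnom z = - Iinj"
    unfolding z_def by (rule pi_equilibrium(1)) (fact assms)+
  have "pi_closed_loop_solution E R C Vnom KP KI Iinj (\<lambda>t. Vnom) (\<lambda>t. z)"
    unfolding z_def by (rule pi_equilibrium(2)) (fact assms)+
  moreover have "\<not> current_sharing E R f Iinj (\<lambda>t. pi_control KP KI Vnom Vnom z)"
  proof
    assume "current_sharing E R f Iinj (\<lambda>t. pi_control KP KI Vnom Vnom z)"
    then have "optimal_injection E R f Iinj = - Iinj"
      by (simp add: current_sharing_def u tendsto_const_iff)
    then have "f a * (- Iinj) $ a = f b * (- Iinj) $ b"
      using optimal_injection_equal_marginal_cost[where f = f and Iinj = Iinj, OF assms(6)] by metis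
    then have "f a = 0"
      using \<open>a \<noteq> b\<close> by (simp add: Iinj_def axis_def)
    then show False
      using assms(6)[of a] by simp
  qed
  ultimately show ?thesis
    by blast
qed

end
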